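(* Let $m\ge 1$ and $k\in\mathbb{N}$. For all $\lambda,x\in\mathbb{R}^m$, $$He_k(\lambda^{\mathrm T}x)=\sum_{\substack{q\in\mathbb{N}^m:\\ |q|\in\{k,k-2,k-4,\ldots\}}}Te_{k,q}(\lambda)\prod_{j=1}^m He_{q_j}(x_j),$$ $$H_k(\lambda^{\mathrm T}x)=\sum_{\substack{q\in\mathbb{N}^m:\\ |q|\in\{k,k-2,k-4,\ldots\}}}T_{k,q}(\lambda)\prod_{j=1}^m H_{q_j}(x_j),$$ where, with $i=\frac{k-|q|}{2}\in\mathbb{N}$, $$Te_{k,q}(\lambda)=\frac{k!}{2^i\,q!\,i!}\,\lambda^{q}\left(\|\lambda\|_2^2-1\right)^i,\qquad T_{k,q}(\lambda)=\frac{k!}{q!\,i!}\,\lambda^{q}\left(\|\lambda\|_2^2-1\right)^i.$$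
   Context: $\mathbb{N}=\{0,1,2,\ldots\}$. For a multi-index $q=(q_1,\ldots,q_m)\in\mathbb{N}^m$ and $\lambda\in\mathbb{R}^m$: $|q|=\sum_j q_j$, $q!=\prod_j q_j!$, $\lambda^{q}=\prod_j\lambda_j^{q_j}$ (with $0^0=1$). $\|\cdot\|_2$ is the Euclidean norm. The sums range over the multi-indices $q$ for which $k-|q|$ is a nonnegative even integer. $He_k$ and $H_k$ are the univariate probabilists' and physicists' Hermite polynomials: $$He_k(y)=(-1)^k e^{y^2/2}\frac{d^k}{dy^k}e^{-y^2/2},\qquad H_k(y)=(-1)^k e^{y^2}\frac{d^k}{dy^k}e^{-y^2},\qquad y\in\mathbb{R}.$$ *)

theory Defs
  imports "HOL-Analysis.Analysis"
begin

definition hermite_He :: "nat \<Rightarrow> real \<Rightarrow> real" where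
  "hermite_He k y = (-1) ^ k * exp (y\<^sup>2 / 2) * (deriv ^^ k) (\<lambda>t. exp (- (t\<^sup>2 / 2))) y"

definition hermite_H :: "nat \<Rightarrow> real \<Rightarrow> real" where
  "hermite_H k y = (-1) ^ k * exp (y\<^sup>2) * (deriv ^^ k) (\<lambda>t. exp (- (t\<^sup>2))) y"

definition mi_abs :: "nat ^ 'm \<Rightarrow> nat" where
  "mi_abs q = (\<Sum>j\<in>UNIV. q $ j)"

definition mi_fact :: "nat ^ 'm \<Rightarrow> real" where
  "mi_fact q = (\<Prod>j\<in>UNIV. fact (q $ j))"

definition mi_power :: "real ^ 'm \<Rightarrow> nat ^ 'm \<Rightarrow> real" where
  "mi_power l q = (\<Prod>j\<in>UNIV. (l $ j) ^ (q $ j))"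

text \<open>The guard \<open>mi_abs q \<le> k\<close> matters because subtraction on \<^typ>\<open>nat\<close> truncates.\<close>

definition mi_index :: "nat \<Rightarrow> (nat ^ 'm) set" where
  "mi_index k = {q. mi_abs q \<le> k \<and> even (k - mi_abs q)}"

text \<open>The index set is finite, so \<^const>\<open>sum\<close> over it is a genuine sum.\<close>

lemma finite_mi_index: "finite (mi_index k :: (nat ^ 'm::finite) set)"
proof (rule finite_subset)
  show "(mi_index k :: (nat ^ 'm) set) \<subseteq> vec_lambda ` (UNIV \<rightarrow>\<^sub>E {..k})"
  proof
    fix q :: "nat ^ 'm"
    assume "q \<in> mi_index k"
    then have le: "(\<Sum>j\<in>UNIV. q $ j) \<le> k"
      by (simp add: mi_index_def mi_abs_def)
    have "q $ j \<le> (\<Sum>j\<in>UNIV. q $ j)" for j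
      by (rule member_le_sum) auto
    with le have "vec_nth q \<in> UNIV \<rightarrow>\<^sub>E {..k}"
      by (auto intro: order_trans)
    then show "q \<in> vec_lambda ` (UNIV \<rightarrow>\<^sub>E {..k})"
      by (rule rev_image_eqI) simp
  qed
  show "finite (vec_lambda ` ((UNIV :: 'm set) \<rightarrow>\<^sub>E {..k}) :: (nat ^ 'm) set)"
    by (intro finite_imageI finite_PiE) auto
qed

text \<open>For \<open>q \<in> mi_index k\<close> the integer division by 2 is exact. On \<^typ>\<open>real ^ 'm\<close>,
  \<^const>\<open>norm\<close> is the Euclidean norm.\<close>

definition coeff_Te :: "nat \<Rightarrow> nat ^ 'm \<Rightarrow> real ^ 'm \<Rightarrow> real" where
  "coeff_Te k q l = (let i = (k - mi_abs q) div 2 in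
     fact k / (2 ^ i * mi_fact q * fact i) * mi_power l q * ((norm l)\<^sup>2 - 1) ^ i)"

definition coeff_T :: "nat \<Rightarrow> nat ^ 'm \<Rightarrow> real ^ 'm \<Rightarrow> real" where
  "coeff_T k q l = (let i = (k - mi_abs q) div 2 in
     fact k / (mi_fact q * fact i) * mi_power l q * ((norm l)\<^sup>2 - 1) ^ i)"

end

theory Submission
  imports Defs
begin

text \<open>With \<open>c = 1/2\<close> for \<open>He\<close> and \<open>c = 1\<close> for \<open>H\<close>, both families have the exponential generating
  function \<open>exp (2cyt - ct\<^sup>2)\<close>, so the theorem compares coefficients of \<open>t\<^sup>k\<close> in
  \<open>exp (2c(\<lambda>\<bullet>x)t - ct\<^sup>2) = (\<Prod>j. exp (2cx\<^sub>j(\<lambda>\<^sub>jt) - c(\<lambda>\<^sub>jt)\<^sup>2)) * exp (c(\<parallel>\<lambda>\<parallel>\<^sup>2 - 1)t\<^sup>2)\<close>.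
  As formal power series in \<open>t\<close>, both sides solve the same first-order linear ODE with constant term 1.\<close>

text \<open>The recurrence is what differentiating
  \<open>hermite_poly c n y * exp (- (c * y^2))\<close> produces, up to sign, once the lowering rule
  below is known. At \<open>n = 0\<close> the truncated index \<open>n - 1\<close> is harmless
  because its factor \<open>real n\<close> vanishes.\<close>

fun hermite_poly :: "real \<Rightarrow> nat \<Rightarrow> real \<Rightarrow> real" where
  "hermite_poly c 0 y = 1"
| "hermite_poly c (Suc n) y =
     2 * c * y * hermite_poly c n y - 2 * c * real n * hermite_poly c (n - 1) y"

text \<open>Strong induction, as the recurrence reaches back two indices. For
  \<open>n = m + 1\<close>, differentiating the explicit factor \<open>y\<close> gives
  \<open>2c\<close> times the polynomial of index \<open>m\<close>; by the recurrence, the remaining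
  terms collapse to \<open>2cm\<close> times the same polynomial.\<close>

lemma hermite_poly_has_derivative:
  "(hermite_poly c n has_real_derivative 2 * c * real n * hermite_poly c (n - 1) y) (at y)"
proof (induction n rule: less_induct)
  case (less n)
  show ?case
  proof (cases n)
    case 0
    then show ?thesis by (simp add: fun_eq_iff)
  next
    case (Suc m)
    have eq: "hermite_poly c n =
        (\<lambda>y. 2 * c * y * hermite_poly c m y - 2 * c * real m * hermite_poly c (m - 1) y)"
      by (simp add: Suc fun_eq_iff)
    have "(hermite_poly c n has_real_derivative
        2 * c * hermite_poly c m y + 2 * c * y * (2 * c * real m * hermite_poly c (m - 1) y)
          - 2 * c * real m * (2 * c * real (m - 1) * hermite_poly c (m - 1 - 1) y)) (at y)"
      unfolding eq
      by (rule derivative_eq_intros less.IH refl | simp add: Suc)+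
    also have "2 * c * hermite_poly c m y + 2 * c * y * (2 * c * real m * hermite_poly c (m - 1) y)
          - 2 * c * real m * (2 * c * real (m - 1) * hermite_poly c (m - 1 - 1) y)
        = 2 * c * real n * hermite_poly c (n - 1) y"
      by (cases m) (simp_all add: Suc algebra_simps)
    finally show ?thesis .
  qed
qed

lemma higher_deriv_gaussian:
  "(deriv ^^ k) (\<lambda>t. exp (- (c * t\<^sup>2))) =
     (\<lambda>t. (-1) ^ k * hermite_poly c k t * exp (- (c * t\<^sup>2)))"
proof (induction k)
  case 0
  then show ?case by simp
next
  case (Suc k)
  \<comment> \<open>The product rule gives the lowering term minus
    \<open>2 * c * t * hermite_poly c k t\<close>, which is the negated recurrence; hence the extra
    sign.\<close>
  have "((\<lambda>t. (-1) ^ k * hermite_poly c k t * exp (- (c * t\<^sup>2))) has_real_derivative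
      (-1) ^ Suc k * hermite_poly c (Suc k) t * exp (- (c * t\<^sup>2))) (at t)" for t
    by (rule derivative_eq_intros hermite_poly_has_derivative refl
        | simp add: algebra_simps)+
  then have "deriv (\<lambda>t. (-1) ^ k * hermite_poly c k t * exp (- (c * t\<^sup>2))) =
      (\<lambda>t. (-1) ^ Suc k * hermite_poly c (Suc k) t * exp (- (c * t\<^sup>2)))"
    by (intro ext DERIV_imp_deriv)
  then show ?case
    by (simp only: funpow.simps o_apply Suc.IH)
qed

lemma hermite_poly_Rodrigues:
  "(-1) ^ k * exp (c * y\<^sup>2) * (deriv ^^ k) (\<lambda>t. exp (- (c * t\<^sup>2))) y = hermite_poly c k y"
proof -
  have "(-1) ^ k * exp (c * y\<^sup>2) * (deriv ^^ k) (\<lambda>t. exp (- (c * t\<^sup>2))) y =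
      ((-1) ^ k * (-1) ^ k) * (exp (c * y\<^sup>2) * exp (- (c * y\<^sup>2))) * hermite_poly c k y"
    unfolding higher_deriv_gaussian by (simp only: mult_ac)
  also have "\<dots> = hermite_poly c k y"
    by (simp flip: exp_add power_mult_distrib)
  finally show ?thesis .
qed

lemma hermite_He_eq: "hermite_He k y = hermite_poly (1 / 2) k y"
  using hermite_poly_Rodrigues[of k "1 / 2" y] by (simp add: hermite_He_def)

lemma hermite_H_eq: "hermite_H k y = hermite_poly 1 k y"
  using hermite_poly_Rodrigues[of k 1 y] by (simp add: hermite_H_def)

text \<open>These are the formal series of \<open>exp (2cy(at) - c(at)\<^sup>2)\<close> and \<open>exp (bt\<^sup>2)\<close> in \<open>t\<close>.\<close>

definition hermite_fps :: "real \<Rightarrow> real \<Rightarrow> real \<Rightarrow> real fps" where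
  "hermite_fps c a y = Abs_fps (\<lambda>n. a ^ n * hermite_poly c n y / fact n)"

definition gauss_fps :: "real \<Rightarrow> real fps" where
  "gauss_fps b = Abs_fps (\<lambda>n. if even n then b ^ (n div 2) / fact (n div 2) else 0)"

text \<open>The three-term recurrence read coefficientwise: \<open>fps_X\<close> shifts the index by
  one, and the factor \<open>n\<close> is absorbed by \<open>n / n! = 1 / (n - 1)!\<close>.\<close>

lemma fps_deriv_hermite_fps:
  "fps_deriv (hermite_fps c a y) =
     (fps_const (2 * c * a * y) - fps_const (2 * c * a\<^sup>2) * fps_X) * hermite_fps c a y"
proof (rule fps_ext)
  fix n
  have "fps_nth (fps_deriv (hermite_fps c a y)) n = a ^ Suc n * hermite_poly c (Suc n) y / fact n"
    by (simp add: hermite_fps_def divide_simps del: hermite_poly.simps of_nat_Suc)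
  also have "\<dots> = fps_nth ((fps_const (2 * c * a * y)
     - fps_const (2 * c * a\<^sup>2) * fps_X) * hermite_fps c a y) n"
  proof (cases n)
    case (Suc m)
    have "real n / fact n = 1 / fact m"
      by (simp add: Suc divide_simps del: of_nat_Suc)
    then have "2 * c * a\<^sup>2 * a ^ m * hermite_poly c m y / fact m =
        2 * c * a\<^sup>2 * a ^ m * hermite_poly c m y * (real n / fact n)"
      by simp
    moreover have "a ^ Suc n * hermite_poly c (Suc n) y / fact n =
        2 * c * a * y * (a ^ n * hermite_poly c n y / fact n)
          - 2 * c * a\<^sup>2 * a ^ m * hermite_poly c m y * (real n / fact n)"
      by (simp add: Suc diff_divide_distrib right_diff_distrib power2_eq_square mult_ac
          del: fact_Suc of_nat_Suc hermite_poly.simps(2)[of c m])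
    ultimately show ?thesis
      by (simp add: Suc hermite_fps_def left_diff_distrib mult.assoc
          del: hermite_poly.simps fact_Suc)
  qed (simp add: hermite_fps_def left_diff_distrib mult.assoc)
  finally show "fps_nth (fps_deriv (hermite_fps c a y)) n = fps_nth ((fps_const (2 * c * a * y)
     - fps_const (2 * c * a\<^sup>2) * fps_X) * hermite_fps c a y) n" .
qed

lemma fps_deriv_gauss_fps:
  "fps_deriv (gauss_fps b) = fps_const (2 * b) * fps_X * gauss_fps b"
proof (rule fps_ext)
  fix n
  show "fps_nth (fps_deriv (gauss_fps b)) n =
      fps_nth (fps_const (2 * b) * fps_X * gauss_fps b) n"
  \<comment> \<open>Differentiation and multiplication by \<open>fps_X\<close> both move the even
    support of \<open>gauss_fps\<close> to odd degrees, so only odd \<open>n\<close> needs a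
    computation.\<close>
  proof (cases "odd n")
    case True
    then obtain i where i: "n = Suc (2 * i)" by (metis oddE Suc_eq_plus1)
    then have "real (Suc n) = 2 * real (Suc i)" by simp
    then have "real (Suc n) * (b ^ Suc i / fact (Suc i)) = 2 * b * (b ^ i / fact i)"
      by (simp add: divide_simps del: of_nat_Suc)
    with i show ?thesis by (simp add: gauss_fps_def mult.assoc del: of_nat_Suc fact_Suc)
  next
    case False
    then show ?thesis by (cases n) (simp_all add: gauss_fps_def mult.assoc)
  qed
qed

text \<open>The equation expresses \<open>m + 1\<close> times coefficient \<open>m + 1\<close>
  through coefficients up to \<open>m\<close>, and \<open>m + 1\<close> is invertible in
  characteristic 0.\<close>

lemma fps_linear_ODE_unique:
  fixes F G U :: "'a::field_char_0 fps"
  assumes F: "fps_deriv F = U * F" and G: "fps_deriv G = U * G"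
    and 0: "fps_nth F 0 = fps_nth G 0"
  shows "F = G"
proof (rule fps_ext)
  fix n
  show "fps_nth F n = fps_nth G n"
  proof (induction n rule: less_induct)
    case (less n)
    show ?case
    proof (cases n)
      case (Suc m)
      have "fps_nth (fps_deriv F) m = fps_nth (fps_deriv G) m"
        unfolding F G fps_mult_nth by (intro sum.cong refl) (simp add: less.IH Suc)
      then show ?thesis by (simp add: Suc del: of_nat_Suc)
    qed (simp add: 0)
  qed
qed

text \<open>Logarithmic derivatives add under products.\<close>

lemma fps_deriv_prod_log:
  fixes F U :: "'a \<Rightarrow> 'b::comm_ring_1 fps"
  assumes "finite A" "\<And>j. j \<in> A \<Longrightarrow> fps_deriv (F j) = U j * F j"
  shows "fps_deriv (\<Prod>j\<in>A. F j) = (\<Sum>j\<in>A. U j) * (\<Prod>j\<in>A. F j)"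
  using assms by (induction A rule: finite_induct) (simp_all add: algebra_simps)

lemma fps_const_sum: "finite A \<Longrightarrow> fps_const (\<Sum>j\<in>A. f j) = (\<Sum>j\<in>A. fps_const (f j))"
  by (induction A rule: finite_induct) (simp_all flip: fps_const_add)

lemma fps_prod_nth_0:
  fixes F :: "'a \<Rightarrow> 'b::comm_ring_1 fps"
  shows "finite A \<Longrightarrow> fps_nth (\<Prod>j\<in>A. F j) 0 = (\<Prod>j\<in>A. fps_nth (F j) 0)"
  by (induction A rule: finite_induct) simp_all

lemma hermite_fps_inner:
  fixes l x :: "real ^ 'm"
  shows "hermite_fps c 1 (l \<bullet> x) =
    (\<Prod>j\<in>UNIV. hermite_fps c (l $ j) (x $ j)) * gauss_fps (c * ((norm l)\<^sup>2 - 1))"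
    (is "_ = ?P * ?G")
proof (rule fps_linear_ODE_unique)
  let ?U = "\<lambda>j. fps_const (2 * c * l $ j * x $ j) - fps_const (2 * c * (l $ j)\<^sup>2) * fps_X"
  show "fps_deriv (hermite_fps c 1 (l \<bullet> x)) =
      (fps_const (2 * c * (l \<bullet> x)) - fps_const (2 * c) * fps_X) * hermite_fps c 1 (l \<bullet> x)"
    by (simp add: fps_deriv_hermite_fps)
  have "(\<Sum>j\<in>UNIV. ?U j) = fps_const (2 * c * (l \<bullet> x)) - fps_const (2 * c * (norm l)\<^sup>2) * fps_X"
    unfolding power2_norm_eq_inner inner_vec_def
    by (simp add: sum_subtractf fps_const_sum sum_distrib_left sum_distrib_right
        power2_eq_square mult.assoc del: fps_const_mult)
  moreover have "fps_deriv ?P = (\<Sum>j\<in>UNIV. ?U j) * ?P"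
    by (rule fps_deriv_prod_log) (simp_all add: fps_deriv_hermite_fps)
  ultimately have P: "fps_deriv ?P =
      (fps_const (2 * c * (l \<bullet> x)) - fps_const (2 * c * (norm l)\<^sup>2) * fps_X) * ?P"
    by (simp only:)
  \<comment> \<open>The Gaussian factor is chosen so that its logarithmic derivative corrects the
    coefficient of \<open>fps_X\<close> from \<open>- 2 * c * (norm l)^2\<close> to
    \<open>- 2 * c\<close>.\<close>
  have "fps_deriv (?P * ?G) = (fps_const (2 * c * (l \<bullet> x))
      - fps_const (2 * c * (norm l)\<^sup>2) * fps_X
      + fps_const (2 * (c * ((norm l)\<^sup>2 - 1))) * fps_X) * (?P * ?G)"
    unfolding fps_deriv_mult P fps_deriv_gauss_fps by (simp only: algebra_simps)
  also have "fps_const (2 * c * (l \<bullet> x)) - fps_const (2 * c * (norm l)\<^sup>2) * fps_X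
      + fps_const (2 * (c * ((norm l)\<^sup>2 - 1))) * fps_X
      = fps_const (2 * c * (l \<bullet> x)) - fps_const (2 * c) * fps_X"
    by (rule fps_ext) (simp add: algebra_simps)
  finally show "fps_deriv (?P * ?G) =
      (fps_const (2 * c * (l \<bullet> x)) - fps_const (2 * c) * fps_X) * (?P * ?G)" .
  show "fps_nth (hermite_fps c 1 (l \<bullet> x)) 0 = fps_nth (?P * ?G) 0"
    by (simp add: hermite_fps_def gauss_fps_def fps_prod_nth_0)
qed

lemma fps_const_prod:
  fixes f :: "'a \<Rightarrow> 'b::comm_ring_1"
  shows "finite A \<Longrightarrow> fps_const (\<Prod>j\<in>A. f j) = (\<Prod>j\<in>A. fps_const (f j))"
  by (induction A rule: finite_induct) (simp_all flip: fps_const_mult)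

text \<open>Low-order coefficients of a product see only low-order coefficients of the factors,
  which permits truncation.\<close>

lemma fps_prod_nth_cong:
  fixes F G :: "'a \<Rightarrow> 'b::comm_ring_1 fps"
  assumes "finite A" "\<And>j m. j \<in> A \<Longrightarrow> m \<le> n \<Longrightarrow> fps_nth (F j) m = fps_nth (G j) m" "m \<le> n"
  shows "fps_nth (\<Prod>j\<in>A. F j) m = fps_nth (\<Prod>j\<in>A. G j) m"
  using assms
proof (induction A arbitrary: m rule: finite_induct)
  case (insert a A)
  then show ?case by (simp add: fps_mult_nth)
qed simp

lemma finite_mi_abs_eq: "finite {q :: nat ^ 'm. mi_abs q = n}"
  by (rule finite_subset[OF _ finite_mi_index[of n]]) (auto simp: mi_index_def)

text \<open>After truncation at degree \<open>n\<close> every factor is a finite sum, so the product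
  expands over a box of exponent functions, and only monomials of total degree \<open>n\<close>
  contribute.\<close>

lemma fps_prod_nth_multi_index:
  fixes F :: "'m::finite \<Rightarrow> 'b::comm_ring_1 fps"
  shows "fps_nth (\<Prod>j\<in>UNIV. F j) n =
    (\<Sum>q | mi_abs q = n. \<Prod>j\<in>UNIV. fps_nth (F j) (q $ j))"
proof -
  let ?E = "(UNIV :: 'm set) \<rightarrow>\<^sub>E {..n}"
  let ?T = "\<lambda>j. \<Sum>i\<le>n. fps_const (fps_nth (F j) i) * fps_X ^ i"
  have T: "fps_nth (?T j) m = fps_nth (F j) m" if "m \<le> n" for j m
    using that by (simp add: fps_sum_nth if_distrib[of "\<lambda>x. _ * x"] cong: if_cong)
  have fin: "finite ?E" by (intro finite_PiE) auto
  have "fps_nth (\<Prod>j\<in>UNIV. F j) n = fps_nth (\<Prod>j\<in>UNIV. ?T j) n"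
    by (rule fps_prod_nth_cong[of _ n]) (simp_all only: T finite order_refl)
  also have "(\<Prod>j\<in>UNIV. ?T j) =
      (\<Sum>p\<in>?E. \<Prod>j\<in>UNIV. fps_const (fps_nth (F j) (p j)) * fps_X ^ p j)"
    by (rule prod_sum_PiE) auto
  also have "\<dots> = (\<Sum>p\<in>?E. fps_const (\<Prod>j\<in>UNIV. fps_nth (F j) (p j)) * fps_X ^ (\<Sum>j\<in>UNIV. p j))"
    by (simp add: prod.distrib power_sum fps_const_prod del: fps_const_mult)
  also have "fps_nth \<dots> n =
      (\<Sum>p\<in>?E. if (\<Sum>j\<in>UNIV. p j) = n then \<Prod>j\<in>UNIV. fps_nth (F j) (p j) else 0)"
    by (auto simp: fps_sum_nth intro!: sum.cong)
  also have "\<dots> = (\<Sum>p | p \<in> ?E \<and> (\<Sum>j\<in>UNIV. p j) = n. \<Prod>j\<in>UNIV. fps_nth (F j) (p j))"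
    using fin by (simp add: sum.inter_filter)
  also have "\<dots> = (\<Sum>q | mi_abs q = n. \<Prod>j\<in>UNIV. fps_nth (F j) (q $ j))"
  proof (rule sum.reindex_bij_witness[of _ vec_nth vec_lambda], goal_cases)
    \<comment> \<open>The box \<open>?E\<close> contains every multi-index of total
      \<open>n\<close>, since no component exceeds the total.\<close>
    case (4 q)
    then have "q $ j \<le> n" for j
      by (auto simp: mi_abs_def intro!: member_le_sum)
    with 4 show ?case by (auto simp: mi_abs_def)
  qed (auto simp: mi_abs_def)
  finally show ?thesis .
qed

text \<open>Both families are treated at once by keeping \<open>c\<close> free. In degree
  \<open>k\<close>, the product supplies degree \<open>mi_abs q\<close> and the Gaussian series the
  remaining \<open>k - mi_abs q\<close>.\<close>

lemma hermite_poly_inner: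
  fixes l x :: "real ^ 'm"
  shows "hermite_poly c k (l \<bullet> x) =
    (\<Sum>q\<in>mi_index k. fact k * c ^ ((k - mi_abs q) div 2)
        / (mi_fact q * fact ((k - mi_abs q) div 2)) * mi_power l q
        * ((norm l)\<^sup>2 - 1) ^ ((k - mi_abs q) div 2)
        * (\<Prod>j\<in>UNIV. hermite_poly c (q $ j) (x $ j)))"
proof -
  let ?g = "\<lambda>i. fps_nth (gauss_fps (c * ((norm l)\<^sup>2 - 1))) i"
  let ?p = "\<lambda>q::nat^'m. \<Prod>j\<in>UNIV. fps_nth (hermite_fps c (l $ j) (x $ j)) (q $ j)"
  let ?S = "{q::nat^'m. mi_abs q \<le> k}"
  have S: "?S = (\<Union>a\<in>{..k}. {q. mi_abs q = a})" by auto
  have fin: "finite ?S" unfolding S by (simp add: finite_mi_abs_eq)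
  have "hermite_poly c k (l \<bullet> x) = fact k * fps_nth (hermite_fps c 1 (l \<bullet> x)) k"
    by (simp add: hermite_fps_def)
  also have "fps_nth (hermite_fps c 1 (l \<bullet> x)) k =
      (\<Sum>a\<le>k. \<Sum>q | mi_abs q = a. ?p q * ?g (k - mi_abs q))"
    by (simp add: hermite_fps_inner fps_mult_nth fps_prod_nth_multi_index sum_distrib_right
        atLeast0AtMost)
  also have "\<dots> = (\<Sum>q\<in>?S. ?p q * ?g (k - mi_abs q))"
    unfolding S by (subst sum.UNION_disjoint) (auto simp: finite_mi_abs_eq)
  \<comment> \<open>Terms with \<open>k - mi_abs q\<close> odd vanish because the Gaussian series is
    even; this is the source of the parity condition.\<close>
  also have "\<dots> = (\<Sum>q\<in>mi_index k. ?p q * ?g (k - mi_abs q))"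
    using fin by (intro sum.mono_neutral_right) (auto simp: mi_index_def gauss_fps_def)
  finally have "hermite_poly c k (l \<bullet> x) = fact k * (\<Sum>q\<in>mi_index k. ?p q * ?g (k - mi_abs q))" .
  moreover have "fact k * (?p q * ?g (k - mi_abs q)) =
      fact k * c ^ ((k - mi_abs q) div 2)
        / (mi_fact q * fact ((k - mi_abs q) div 2)) * mi_power l q
        * ((norm l)\<^sup>2 - 1) ^ ((k - mi_abs q) div 2)
        * (\<Prod>j\<in>UNIV. hermite_poly c (q $ j) (x $ j))" if "q \<in> mi_index k" for q
  proof -
    have "even (k - mi_abs q)" using that unfolding mi_index_def by blast
    then have "?g (k - mi_abs q) = c ^ ((k - mi_abs q) div 2)
        * ((norm l)\<^sup>2 - 1) ^ ((k - mi_abs q) div 2) / fact ((k - mi_abs q) div 2)"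
      by (simp only: gauss_fps_def fps_nth_Abs_fps if_True power_mult_distrib)
    then show ?thesis
      by (simp add: hermite_fps_def mi_fact_def mi_power_def prod.distrib prod_dividef mult_ac)
  qed
  ultimately show ?thesis by (simp add: sum_distrib_left)
qed

theorem mainTheorem2:
  fixes k :: nat and l x :: "real ^ 'm"
  shows "hermite_He k (l \<bullet> x) =
           (\<Sum>q\<in>mi_index k. coeff_Te k q l * (\<Prod>j\<in>UNIV. hermite_He (q $ j) (x $ j)))
       \<and> hermite_H k (l \<bullet> x) =
           (\<Sum>q\<in>mi_index k. coeff_T k q l * (\<Prod>j\<in>UNIV. hermite_H (q $ j) (x $ j)))"
  \<comment> \<open>With \<open>i = (k - mi_abs q) div 2\<close>, the factor \<open>c ^ i\<close> is
    \<open>1 / 2 ^ i\<close> for \<open>c = 1/2\<close> and 1 for \<open>c = 1\<close>.\<close>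
  by (simp add: hermite_He_eq hermite_H_eq hermite_poly_inner coeff_Te_def coeff_T_def Let_def
      power_one_over mult_ac)

end
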